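(* Let $n\ge2$, let $P_n=\{p_1,\dots,p_n\}$ be a poset with $n$ elements such that $p_i\le p_j$ implies $i\le j$, and let $G_n=G(P_n)$. Let $G_{n-1}=G(P_{n-1})$ where $P_{n-1}=\{p_1,\dots,p_{n-1}\}$ is the induced subposet. Then a subset $C_n\subset V_n$ is a minimal vertex cover of $G_n$ if and only if either $C_n=C_{n-1}\cup\{y_n\}$, where $C_{n-1}\subset V_{n-1}$ is a minimal vertex cover of $G_{n-1}$, or $C_n=C_{n-1}\cup\{x_n\}$, where $C_{n-1}\subset V_{n-1}$ is a minimal vertex cover of $G_{n-1}$ such that $x_i\in C_{n-1}$ for each $i\in[n-1]$ with $p_i\le p_n$.
   Context: $[m]=\{1,\dots,m\}$ and $V_m=\{x_1,\dots,x_m\}\cup\{y_1,\dots,y_m\}$. For a poset $P_m=\{p_1,\dots,p_m\}$, $G(P_m)$ is the bipartite graph on $V_m$ whose edges are all $\{x_i,y_j\}$ with $p_i\le p_j$. A vertex cover of a graph is a set of vertices meeting every edge; it is minimal if no proper subset of it is a vertex cover. *)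

theory Defs
  imports Main
begin

text \<open>A simple graph is given by its vertex set and its set of edges, an edge being the
  set of its endpoints.\<close>

type_synonym 'v graph = "'v set \<times> 'v set set"

definition vertex_cover :: "'v graph \<Rightarrow> 'v set \<Rightarrow> bool" where
  "vertex_cover G C \<longleftrightarrow> C \<subseteq> fst G \<and> (\<forall>e\<in>snd G. e \<inter> C \<noteq> {})"

definition minimal_vertex_cover :: "'v graph \<Rightarrow> 'v set \<Rightarrow> bool" where
  "minimal_vertex_cover G C \<longleftrightarrow> vertex_cover G C \<and> (\<forall>D. D \<subset> C \<longrightarrow> \<not> vertex_cover G D)"

datatype vertex = X nat | Y nat

definition V :: "nat \<Rightarrow> vertex set" where
  "V m = X ` {1..m} \<union> Y ` {1..m}"

text \<open>The poset \<open>P\<^sub>m\<close> has the elements \<open>p 1, \<dots>, p m\<close>; \<open>r\<close> is its (reflexive) order,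
  \<open>(a, b) \<in> r\<close> meaning \<open>a \<le> b\<close>.\<close>

definition poset_graph :: "(nat \<Rightarrow> 'a) \<Rightarrow> nat \<Rightarrow> 'a rel \<Rightarrow> vertex graph" where
  "poset_graph p m r =
     (V m, {{X i, Y j} | i j. i \<in> {1..m} \<and> j \<in> {1..m} \<and> (p i, p j) \<in> r})"

end

theory Submission
  imports Defs
begin

text \<open>Reflexivity and transitivity force a minimal vertex cover to contain exactly one of
  \<open>x\<^sub>i\<close>, \<open>y\<^sub>i\<close> for each \<open>i\<close>, and every vertex cover with this property is minimal.
  With this description of the minimal covers of both graphs, the two cases of the theorem are
  \<open>y\<^sub>n \<in> C\<close> and \<open>x\<^sub>n \<in> C\<close>: since the order respects the indices, the only edge at \<open>x\<^sub>n\<close> is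
  \<open>{x\<^sub>n, y\<^sub>n}\<close>, while the edges at \<open>y\<^sub>n\<close> are covered without \<open>y\<^sub>n\<close> iff \<open>x\<^sub>i \<in> C\<close> whenever
  \<open>p\<^sub>i \<le> p\<^sub>n\<close>.\<close>

lemma X_in_V [simp]: "X i \<in> V m \<longleftrightarrow> i \<in> {1..m}"
  and Y_in_V [simp]: "Y i \<in> V m \<longleftrightarrow> i \<in> {1..m}"
  by (auto simp: V_def)

lemma vertex_cover_poset_graph_iff:
  "vertex_cover (poset_graph p m r) C \<longleftrightarrow>
    C \<subseteq> V m \<and> (\<forall>i\<in>{1..m}. \<forall>j\<in>{1..m}. (p i, p j) \<in> r \<longrightarrow> X i \<in> C \<or> Y j \<in> C)"
proof -
  have edges: "(\<forall>e\<in>snd (poset_graph p m r). Q e) \<longleftrightarrow>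
      (\<forall>i\<in>{1..m}. \<forall>j\<in>{1..m}. (p i, p j) \<in> r \<longrightarrow> Q {X i, Y j})" for Q
    unfolding poset_graph_def snd_conv by blast
  have "fst (poset_graph p m r) = V m"
    by (simp add: poset_graph_def)
  moreover have "{X i, Y j} \<inter> C \<noteq> {} \<longleftrightarrow> X i \<in> C \<or> Y j \<in> C" for i j
    by blast
  ultimately show ?thesis
    by (simp only: vertex_cover_def edges)
qed

text \<open>This replaces the quantification over all proper subsets by one condition per index, so
  that minimality can be compared between the graphs of \<open>r\<close> and of its
  restriction.\<close>

lemma minimal_vertex_cover_poset_graph_iff:
  assumes refl: "\<And>i. i \<in> {1..m} \<Longrightarrow> (p i, p i) \<in> r" and "trans r"
  shows "minimal_vertex_cover (poset_graph p m r) C \<longleftrightarrow>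
    vertex_cover (poset_graph p m r) C \<and> (\<forall>i\<in>{1..m}. X i \<in> C \<longleftrightarrow> Y i \<notin> C)"
proof
  assume min: "minimal_vertex_cover (poset_graph p m r) C"
  then have cover: "vertex_cover (poset_graph p m r) C"
    by (simp add: minimal_vertex_cover_def)
  have remove: "\<not> vertex_cover (poset_graph p m r) (C - {v})" if "v \<in> C" for v
    using min that unfolding minimal_vertex_cover_def by blast
  have "X i \<in> C \<longleftrightarrow> Y i \<notin> C" if i: "i \<in> {1..m}" for i
  proof -
    have "X i \<in> C \<or> Y i \<in> C"
      using cover i refl by (auto simp: vertex_cover_poset_graph_iff)
    moreover have False if XY: "X i \<in> C" "Y i \<in> C"
    proof -
      \<comment> \<open>Without \<open>X i\<close> some edge {\<open>X i\<close>,
        \<open>Y j\<close>} is uncovered, without \<open>Y i\<close> some edge {\<open>X k\<close>,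
        \<open>Y i\<close>}. By transitivity {\<open>X k\<close>, \<open>Y j\<close>} is an edge
        too, and \<open>C\<close> misses both of its ends.\<close>
      obtain j where "j \<in> {1..m}" "(p i, p j) \<in> r" "Y j \<notin> C"
        using remove[OF XY(1)] cover unfolding vertex_cover_poset_graph_iff by blast
      moreover obtain k where "k \<in> {1..m}" "(p k, p i) \<in> r" "X k \<notin> C"
        using remove[OF XY(2)] cover unfolding vertex_cover_poset_graph_iff by blast
      ultimately show False
        using cover transD[OF \<open>trans r\<close>] unfolding vertex_cover_poset_graph_iff by blast
    qed
    ultimately show ?thesis
      by blast
  qed
  with cover show "vertex_cover (poset_graph p m r) C \<and> (\<forall>i\<in>{1..m}. X i \<in> C \<longleftrightarrow> Y i \<notin> C)"
    by blast
next
  assume C: "vertex_cover (poset_graph p m r) C \<and> (\<forall>i\<in>{1..m}. X i \<in> C \<longleftrightarrow> Y i \<notin> C)"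
  have "\<not> vertex_cover (poset_graph p m r) D" if D: "D \<subset> C" for D
  proof
    assume cover: "vertex_cover (poset_graph p m r) D"
    obtain v where v: "v \<in> C" "v \<notin> D"
      using D by blast
    with C have "v \<in> V m"
      by (auto simp: vertex_cover_poset_graph_iff)
    then obtain i where i: "i \<in> {1..m}" "v = X i \<or> v = Y i"
      by (auto simp: V_def)
    \<comment> \<open>\<open>D\<close> must meet the edge {\<open>X i\<close>, \<open>Y i\<close>}.
      It lacks \<open>v\<close>, one of the two ends, and the other end is not even in
      \<open>C\<close>.\<close>
    have "X i \<in> D \<or> Y i \<in> D"
      using cover i(1) refl[OF i(1)] unfolding vertex_cover_poset_graph_iff by blast
    with C D v i show False by blast
  qed
  with C show "minimal_vertex_cover (poset_graph p m r) C"
    by (simp add: minimal_vertex_cover_def)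
qed

theorem proposition2p2:
  fixes n :: nat and p :: "nat \<Rightarrow> 'a" and r :: "'a rel" and C :: "vertex set"
  assumes "n \<ge> 2"
    and "inj_on p {1..n}"
    and "partial_order_on (p ` {1..n}) r"
    and "\<forall>i\<in>{1..n}. \<forall>j\<in>{1..n}. (p i, p j) \<in> r \<longrightarrow> i \<le> j"
    and "C \<subseteq> V n"
  defines "G \<equiv> poset_graph p n r"
    and "G' \<equiv> poset_graph p (n - 1) (Restr r (p ` {1..n - 1}))"
  shows "minimal_vertex_cover G C \<longleftrightarrow>
    (\<exists>C'. C' \<subseteq> V (n - 1) \<and> minimal_vertex_cover G' C' \<and> C = C' \<union> {Y n}) \<or>
    (\<exists>C'. C' \<subseteq> V (n - 1) \<and> minimal_vertex_cover G' C' \<and>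
       (\<forall>i\<in>{1..n - 1}. (p i, p n) \<in> r \<longrightarrow> X i \<in> C') \<and> C = C' \<union> {X n})"
proof -
  obtain m where n: "n = Suc m"
    using assms(1) by (cases n) auto
  have range: "{1..n} = insert n {1..m}" and notin: "n \<notin> {1..m}"
    using n by auto
  have Vn: "V n = V m \<union> {X n, Y n}"
    unfolding V_def range by auto
  have new: "X n \<notin> V m" "Y n \<notin> V m"
    using notin by simp_all
  have refl: "(p i, p i) \<in> r" if "i \<in> {1..n}" for i
    using assms(3) that by (auto simp: partial_order_on_def preorder_on_def refl_on_def)
  have "trans r"
    using assms(3) by (auto simp: partial_order_on_def preorder_on_def)
  have no_edge: "(p n, p j) \<notin> r" if "j \<in> {1..m}" for j
  proof
    assume "(p n, p j) \<in> r"
    then have "n \<le> j"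
      using assms(4) that range by blast
    with that n show False by simp
  qed
  have G: "minimal_vertex_cover G D \<longleftrightarrow> D \<subseteq> V n \<and>
      (\<forall>i\<in>{1..n}. \<forall>j\<in>{1..n}. (p i, p j) \<in> r \<longrightarrow> X i \<in> D \<or> Y j \<in> D) \<and>
      (\<forall>i\<in>{1..n}. X i \<in> D \<longleftrightarrow> Y i \<notin> D)" for D
    unfolding G_def
    by (subst minimal_vertex_cover_poset_graph_iff[OF refl \<open>trans r\<close>])
      (simp_all only: vertex_cover_poset_graph_iff conj_assoc)
  have trans': "trans (Restr r (p ` {1..m}))"
    using \<open>trans r\<close> by (rule trans_Restr)
  have refl': "(p i, p i) \<in> Restr r (p ` {1..m})" if "i \<in> {1..m}" for i
    using that refl[of i] range by blast
  have Restr_iff: "(p i, p j) \<in> Restr r (p ` {1..m}) \<longleftrightarrow> (p i, p j) \<in> r"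
    if "i \<in> {1..m}" "j \<in> {1..m}" for i j
    using that by blast
  have "n - 1 = m"
    using n by simp
  \<comment> \<open>Only indices in \<open>{1..m}\<close> occur here, and on these the restricted
    order agrees with \<open>r\<close>.\<close>
  have G': "minimal_vertex_cover G' D \<longleftrightarrow> D \<subseteq> V m \<and>
      (\<forall>i\<in>{1..m}. \<forall>j\<in>{1..m}. (p i, p j) \<in> r \<longrightarrow> X i \<in> D \<or> Y j \<in> D) \<and>
      (\<forall>i\<in>{1..m}. X i \<in> D \<longleftrightarrow> Y i \<notin> D)" for D
    unfolding G'_def \<open>n - 1 = m\<close>
    by (subst minimal_vertex_cover_poset_graph_iff[OF refl' trans'])
      (simp_all only: vertex_cover_poset_graph_iff conj_assoc Restr_iff cong: ball_cong)
  \<comment> \<open>Hence adding \<open>X n\<close> or \<open>Y n\<close> leaves every condition on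
    indices in \<open>{1..m}\<close> unchanged; only the conditions that involve \<open>n\<close>
    remain to be examined.\<close>
  have neq: "i \<noteq> n" if "i \<in> {1..m}" for i
    using that notin by blast
  \<comment> \<open>\<open>Y n\<close> covers all edges at y\<open>\<^sub>n\<close>. As
    \<open>X n\<close> is absent, an edge {\<open>X n\<close>, \<open>Y j\<close>} with j \<le> m
    could put a demand on \<open>C'\<close>; \<open>no_edge\<close> excludes it.\<close>
  have Y_case: "minimal_vertex_cover G (C' \<union> {Y n}) \<longleftrightarrow> minimal_vertex_cover G' C'"
    if "C' \<subseteq> V m" for C'
  proof -
    have "X n \<notin> C'" "Y n \<notin> C'"
      using that new by auto
    then show ?thesis
      using that unfolding G G' range Vn
      by (simp add: neq no_edge subset_insertI2 del: atLeastAtMost_iff cong: ball_cong)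
  qed
  \<comment> \<open>\<open>X n\<close> covers every edge at x\<open>\<^sub>n\<close>. As
    \<open>Y n\<close> is absent, each other edge {\<open>X i\<close>, \<open>Y n\<close>} has to be
    covered by \<open>X i\<close>, which is the extra condition.\<close>
  have X_case: "minimal_vertex_cover G (C' \<union> {X n}) \<longleftrightarrow> minimal_vertex_cover G' C' \<and>
      (\<forall>i\<in>{1..m}. (p i, p n) \<in> r \<longrightarrow> X i \<in> C')" if "C' \<subseteq> V m" for C'
  proof -
    have "X n \<notin> C'" "Y n \<notin> C'"
      using that new by auto
    then show ?thesis
      using that unfolding G G' range Vn
      by (simp add: neq subset_insertI2 ball_conj_distrib conj_commute conj_left_commute
        del: atLeastAtMost_iff cong: ball_cong)
  qed
  have split: "\<exists>C'\<subseteq>V m. C = C' \<union> {Y n} \<or> C = C' \<union> {X n}" if "minimal_vertex_cover G C"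
  proof -
    have "X n \<in> C \<longleftrightarrow> Y n \<notin> C"
      using that range unfolding G by blast
    \<comment> \<open>Exactly one of \<open>X n\<close>, \<open>Y n\<close> lies in
      \<open>C\<close>; deleting it leaves a subset of \<open>V m\<close>.\<close>
    then show ?thesis
      using assms(5) unfolding Vn by (intro exI[of _ "C - {X n, Y n}"]) auto
  qed
  \<comment> \<open>Minimality is still stated in \<open>G\<close> here, for \<open>C\<close>
    rewritten as a union; \<open>Y_case\<close> and \<open>X_case\<close> then carry it over to
    \<open>G'\<close>.\<close>
  have "minimal_vertex_cover G C \<longleftrightarrow>
    (\<exists>C'. C' \<subseteq> V m \<and> minimal_vertex_cover G (C' \<union> {Y n}) \<and> C = C' \<union> {Y n}) \<or>
    (\<exists>C'. C' \<subseteq> V m \<and> minimal_vertex_cover G (C' \<union> {X n}) \<and> C = C' \<union> {X n})"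
    using split by metis
  then show ?thesis
    by (simp only: \<open>n - 1 = m\<close> X_case Y_case conj_assoc cong: conj_cong)
qed

end
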